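(* Let $f:\mathbb{N}\setminus\{0\}\to\mathbb{N}$ be any computable function. Then the following two statements cannot both be true: (i) for each positive integer $n$, if a system $S\subseteq E_n$ has only finitely many solutions in integers $x_1,\ldots,x_n$, then each such solution $(x_1,\ldots,x_n)$ satisfies $|x_1|,\ldots,|x_n|\le f(n)$; (ii) Matiyasevich's conjecture (stated in the context).
   Context: $\mathbb{N}$ denotes the set of non-negative integers. For a positive integer $n$, let $E_n=\{x_i=1,\ x_i+x_j=x_k,\ x_i\cdot x_j=x_k:\ i,j,k\in\{1,\ldots,n\}\}$ be the set of all formal equations of these forms in the variables $x_1,\ldots,x_n$ (indices may coincide). A system $S\subseteq E_n$ is solved by a tuple if the tuple satisfies every equation in $S$. Matiyasevich's conjecture: every recursively enumerable set $\mathcal{M}\subseteq\mathbb{N}^n$ ($n\ge 1$) has a finite-fold Diophantine representation, i.e. there are $m$ and a polynomial $W$ with integer coefficients in $n+m$ variables such that for all $(a_1,\ldots,a_n)\in\mathbb{N}^n$: $(a_1,\ldots,a_n)\in\mathcal{M}$ if and only if there exist $x_1,\ldots,x_m\in\mathbb{N}$ with $W(a_1,\ldots,a_n,x_1,\ldots,x_m)=0$; and for any $a_1,\ldots,a_n\in\mathbb{N}$ the equation $W(a_1,\ldots,a_n,x_1,\ldots,x_m)=0$ has at most finitely many solutions $(x_1,\ldots,x_m)\in\mathbb{N}^m$. *)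

theory Defs
  imports Main "HOL-Library.Poly_Mapping"
begin

text \<open>Tuples are lists throughout; the variable written \<open>x\<^sub>i\<close> on paper, with indices starting
  at 1, is the list entry with index \<open>i - 1\<close>.\<close>

datatype recf =
    Zero
  | Succ
  | Proj nat
  | Comp recf "recf list"
  | PrimRec recf recf
  | Mu recf

fun has_arity :: "recf \<Rightarrow> nat \<Rightarrow> bool" where
  "has_arity Zero n \<longleftrightarrow> True"
| "has_arity Succ n \<longleftrightarrow> n = 1"
| "has_arity (Proj i) n \<longleftrightarrow> i < n"
| "has_arity (Comp f gs) n \<longleftrightarrow> has_arity f (length gs) \<and> (\<forall>g\<in>set gs. has_arity g n)"
| "has_arity (PrimRec g h) n \<longleftrightarrow> n > 0 \<and> has_arity g (n - 1) \<and> has_arity h (n + 1)"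
| "has_arity (Mu f) n \<longleftrightarrow> has_arity f (n + 1)"

text \<open>\<open>rec_eval r xs y\<close>: the partial function denoted by \<open>r\<close> is defined at \<open>xs\<close>, with value \<open>y\<close>.
  Both the recursion variable and the variable bound by minimization come first.\<close>

inductive rec_eval :: "recf \<Rightarrow> nat list \<Rightarrow> nat \<Rightarrow> bool" where
  zero: "rec_eval Zero xs 0"
| succ: "rec_eval Succ [x] (Suc x)"
| proj: "i < length xs \<Longrightarrow> rec_eval (Proj i) xs (xs ! i)"
| comp: "list_all2 (\<lambda>g y. rec_eval g xs y) gs ys \<Longrightarrow> rec_eval f ys z \<Longrightarrow> rec_eval (Comp f gs) xs z"
| primrec_0: "rec_eval g xs y \<Longrightarrow> rec_eval (PrimRec g h) (0 # xs) y"
| primrec_Suc: "rec_eval (PrimRec g h) (k # xs) y \<Longrightarrow> rec_eval h (k # y # xs) z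
    \<Longrightarrow> rec_eval (PrimRec g h) (Suc k # xs) z"
| mu: "rec_eval f (k # xs) 0 \<Longrightarrow> (\<forall>j<k. \<exists>y>0. rec_eval f (j # xs) y) \<Longrightarrow> rec_eval (Mu f) xs k"

lemma rec_eval_deterministic:
  assumes "rec_eval r xs y" "rec_eval r xs y'"
  shows "y = y'"
  using assms
proof (induction arbitrary: y' rule: rec_eval.induct)
  case (zero xs)
  then show ?case by (cases rule: rec_eval.cases) simp
next
  case (succ x)
  then show ?case by (cases rule: rec_eval.cases) simp
next
  case (proj i xs)
  from proj.prems show ?case by (cases rule: rec_eval.cases) simp
next
  case (comp xs gs ys f z)
  from comp.prems obtain ys' where ys': "list_all2 (\<lambda>g y. rec_eval g xs y) gs ys'"
    and z': "rec_eval f ys' y'"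
    by (cases rule: rec_eval.cases) simp
  have "ys = ys'"
    using comp.IH(1) ys' by (simp add: list_all2_conv_all_nth list_eq_iff_nth_eq)
  with comp.IH(2) z' show ?case by simp
next
  case (primrec_0 g xs y h)
  from primrec_0.prems have "rec_eval g xs y'"
    by (cases rule: rec_eval.cases) simp
  with primrec_0.IH show ?case by simp
next
  case (primrec_Suc g h k xs y z)
  from primrec_Suc.prems obtain v where "rec_eval (PrimRec g h) (k # xs) v"
    and "rec_eval h (k # v # xs) y'"
    by (cases rule: rec_eval.cases) simp
  with primrec_Suc.IH show ?case by metis
next
  case (mu f k xs)
  from mu.prems have *: "rec_eval f (y' # xs) 0" "\<forall>j<y'. \<exists>y>0. rec_eval f (j # xs) y"
    by (cases rule: rec_eval.cases; simp)+
  show ?case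
  proof (cases k y' rule: linorder_cases)
    case less
    with *(2) obtain y where "y > 0" "rec_eval f (k # xs) y" by metis
    with mu.IH(1) show ?thesis by (metis less_irrefl)
  next
    case greater
    with mu.IH(2) obtain y where "y > 0" "\<forall>v. rec_eval f (y' # xs) v \<longrightarrow> y = v" by metis
    with *(1) show ?thesis by (metis less_irrefl)
  qed
qed

text \<open>A function on the positive integers is modelled by a total one whose value at 0 is
  irrelevant; accordingly nothing is required of the computation at 0.\<close>

definition computable_on_positive :: "(nat \<Rightarrow> nat) \<Rightarrow> bool" where
  "computable_on_positive f \<longleftrightarrow> (\<exists>r. has_arity r 1 \<and> (\<forall>n\<ge>1. rec_eval r [n] (f n)))"

definition recursively_enumerable :: "nat \<Rightarrow> nat list set \<Rightarrow> bool" where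
  "recursively_enumerable n M \<longleftrightarrow>
     (\<exists>r. has_arity r n \<and> M = {a. length a = n \<and> (\<exists>y. rec_eval r a y)})"

text \<open>A polynomial maps monomials to coefficients, a monomial maps variables to exponents;
  both maps have finite support.\<close>

type_synonym int_mpoly = "(nat \<Rightarrow>\<^sub>0 nat) \<Rightarrow>\<^sub>0 int"

definition mpoly_vars :: "int_mpoly \<Rightarrow> nat set" where
  "mpoly_vars W = (\<Union>t\<in>Poly_Mapping.keys W. Poly_Mapping.keys t)"

definition mpoly_eval :: "int_mpoly \<Rightarrow> int list \<Rightarrow> int" where
  "mpoly_eval W v =
     (\<Sum>t\<in>Poly_Mapping.keys W. Poly_Mapping.lookup W t *
        (\<Prod>i\<in>Poly_Mapping.keys t. v ! i ^ Poly_Mapping.lookup t i))"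

definition finite_fold_diophantine :: "nat \<Rightarrow> nat list set \<Rightarrow> bool" where
  "finite_fold_diophantine n M \<longleftrightarrow>
     (\<exists>m W. mpoly_vars W \<subseteq> {..<n + m} \<and>
        (\<forall>a. length a = n \<longrightarrow>
           (a \<in> M \<longleftrightarrow> (\<exists>x. length x = m \<and> mpoly_eval W (map int (a @ x)) = 0))) \<and>
        (\<forall>a. length a = n \<longrightarrow>
           finite {x. length x = m \<and> mpoly_eval W (map int (a @ x)) = 0}))"

definition matiyasevich_conjecture :: bool where
  "matiyasevich_conjecture \<longleftrightarrow>
     (\<forall>n\<ge>1. \<forall>M. recursively_enumerable n M \<longrightarrow> finite_fold_diophantine n M)"

text \<open>\<open>One i\<close>, \<open>Add i j k\<close>, \<open>Mul i j k\<close> stand for \<open>x!i = 1\<close>, \<open>x!i + x!j = x!k\<close>, \<open>x!i * x!j = x!k\<close>.\<close>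

datatype equation = One nat | Add nat nat nat | Mul nat nat nat

definition E :: "nat \<Rightarrow> equation set" where
  "E n = {One i | i. i < n}
       \<union> {Add i j k | i j k. i < n \<and> j < n \<and> k < n}
       \<union> {Mul i j k | i j k. i < n \<and> j < n \<and> k < n}"

fun satisfies :: "int list \<Rightarrow> equation \<Rightarrow> bool" where
  "satisfies x (One i) \<longleftrightarrow> x ! i = 1"
| "satisfies x (Add i j k) \<longleftrightarrow> x ! i + x ! j = x ! k"
| "satisfies x (Mul i j k) \<longleftrightarrow> x ! i * x ! j = x ! k"

definition solutions :: "nat \<Rightarrow> equation set \<Rightarrow> int list set" where
  "solutions n S = {x. length x = n \<and> (\<forall>e\<in>S. satisfies x e)}"

end

theory Submission
  imports Defs "HOL-Computational_Algebra.Primes"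
begin

text \<open>Suppose that both statements hold. The graph of the function \<open>h k = f (2 * k) + 1\<close>, for
\<open>k \<ge> 1\<close>, is the corresponding part of a recursively enumerable set
(\<open>recursively_enumerable_Suc_double_graph\<close>), which by Matiyasevich's conjecture has a finite-fold
Diophantine representation by some polynomial \<open>W\<close>. For each fixed \<open>k \<ge> 1\<close> the equation
\<open>W (k, y, x\<^sub>1, \<dots>, x\<^sub>m) = 0\<close> then has at least one and only finitely many natural solutions, and
all of them have \<open>y = h k\<close>.

This equation can be turned into a system of equations of the three elementary forms with exactly
\<open>2 * k\<close> integer variables, for a large \<open>k\<close>. Nonnegativity of an unknown is expressed by writing it
as a sum of four squares (\<open>lagrange_four_squares\<close>), in finitely many ways. The resulting polynomial
is evaluated by auxiliary variables that are uniquely determined (\<open>polyfun_computes\<close>) and whose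
number does not depend on \<open>k\<close>. Only the value \<open>k\<close> itself needs \<open>k\<close> further variables
(\<open>system_for_zeros\<close>), so \<open>2 * k\<close> variables are enough once \<open>k\<close> reaches that constant.

The system has finitely many solutions, and one of them contains \<open>f (2 * k) + 1\<close>
(\<open>finite_system_with_large_solution\<close>). This contradicts the bound \<open>f n\<close> for \<open>n = 2 * k\<close>.\<close>

section \<open>Sums of four squares\<close>

definition sum_of_four_squares :: "int \<Rightarrow> bool" where
  "sum_of_four_squares n \<longleftrightarrow> (\<exists>a b c d. n = a\<^sup>2 + b\<^sup>2 + c\<^sup>2 + d\<^sup>2)"

lemma euler_four_squares:
  fixes a b c d w x y z :: "'a :: comm_ring_1"
  shows "(a\<^sup>2 + b\<^sup>2 + c\<^sup>2 + d\<^sup>2) * (w\<^sup>2 + x\<^sup>2 + y\<^sup>2 + z\<^sup>2) =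
    (a*w + b*x + c*y + d*z)\<^sup>2 + (a*x - b*w + c*z - d*y)\<^sup>2 +
    (a*y - c*w + d*x - b*z)\<^sup>2 + (a*z - d*w + b*y - c*x)\<^sup>2"
  by (simp add: power2_eq_square algebra_simps)

lemma sum_of_four_squares_mult:
  assumes "sum_of_four_squares m" "sum_of_four_squares n"
  shows "sum_of_four_squares (m * n)"
  using assms
  unfolding sum_of_four_squares_def by (metis euler_four_squares)

text \<open>Residues of least absolute value are what makes the descent below decrease: four numbers of
absolute value at most \<open>m / 2\<close> have squares adding up to at most \<open>m\<^sup>2\<close>.\<close>

lemma centred_residue:
  fixes m x :: int
  assumes "m > 0"
  obtains y where "m dvd x - y" "2 * \<bar>y\<bar> \<le> m"
proof (cases "2 * (x mod m) \<le> m")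
  case True
  then show ?thesis using assms by (intro that[of "x mod m"]) auto
next
  case False
  have "x mod m < m" using assms by simp
  moreover have "m dvd x - (x mod m - m)"
    by (metis add.commute diff_diff_eq2 dvd_add_right_iff dvd_minus_mod dvd_refl add_diff_eq)
  moreover from this False \<open>x mod m < m\<close> have "2 * \<bar>x mod m - m\<bar> \<le> m" by (simp add: abs_of_neg)
  ultimately show ?thesis by (intro that[of "x mod m - m"])
qed

lemma inj_on_square_mod_prime:
  fixes p :: int
  assumes "prime p" 
  shows "inj_on (\<lambda>a. a\<^sup>2 mod p) {a. 0 \<le> a \<and> 2 * a < p}"
proof (rule inj_onI, clarsimp)
  fix a b :: int
  assume ab: "0 \<le> a" "2 * a < p" "0 \<le> b" "2 * b < p" "a\<^sup>2 mod p = b\<^sup>2 mod p"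
  then have "p dvd (a - b) * (a + b)"
    by (simp add: mod_eq_dvd_iff power2_eq_square algebra_simps)
  then consider "p dvd a - b" | "p dvd a + b"
    using assms prime_dvd_mult_iff by blast
  then show "a = b"
  proof cases
    case 1
    then show ?thesis using ab zdvd_imp_le[of p "a - b"] zdvd_imp_le[of p "b - a"]
      by (cases a b rule: linorder_cases) (auto simp: dvd_diff_commute)
  next
    case 2
    then show ?thesis using ab zdvd_imp_le[of p "a + b"] by (cases "a + b = 0") auto
  qed
qed

text \<open>Each of the sets of residues \<open>a\<^sup>2\<close> and \<open>- 1 - b\<^sup>2\<close>, with \<open>a\<close> and \<open>b\<close> ranging over
\<open>0, \<dots>, (p - 1) / 2\<close>, has \<open>(p + 1) / 2\<close> elements. Together that exceeds the number \<open>p\<close> of all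
residues, so the sets meet.\<close>

lemma prime_dvd_two_squares_plus_one:
  fixes p :: int
  assumes "prime p" "odd p"
  obtains a b where "0 \<le> a" "2 * a < p" "0 \<le> b" "2 * b < p" "p dvd a\<^sup>2 + b\<^sup>2 + 1"
proof -
  define I where "I = {a. 0 \<le> a \<and> 2 * a < p}"
  define q where "q = (p - 1) div 2"
  have p0: "p > 0" using assms prime_gt_0_int by blast
  have p: "p = 2 * q + 1" using assms by (simp add: q_def)
  have I: "I = {0..q}" unfolding I_def p by auto
  have cI: "card I = nat (q + 1)" "finite I" by (auto simp: I)
  define f g where "f = (\<lambda>a. a\<^sup>2 mod p)" and "g = (\<lambda>b. (- 1 - b\<^sup>2) mod p)"
  have f: "inj_on f I" using inj_on_square_mod_prime[OF assms(1)] by (simp add: f_def I_def)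
  have g: "inj_on g I"
  proof (rule inj_onI)
    fix a b assume ab: "a \<in> I" "b \<in> I" "g a = g b"
    then have "f a = f b"
      by (simp add: f_def g_def mod_eq_dvd_iff dvd_diff_commute)
    then show "a = b" using f ab by (auto dest: inj_onD)
  qed
  have sub: "f ` I \<union> g ` I \<subseteq> {0..<p}" using p0 by (auto simp: f_def g_def)
  have "f ` I \<inter> g ` I \<noteq> {}"
  proof
    assume "f ` I \<inter> g ` I = {}"
    then have "card (f ` I \<union> g ` I) = card I + card I"
      using cI f g by (simp add: card_Un_disjoint card_image)
    moreover have "card (f ` I \<union> g ` I) \<le> card {0..<p}" using sub by (intro card_mono) auto
    ultimately show False using cI p p0 by simp
  qed
  then obtain a b where ab: "a \<in> I" "b \<in> I" "f a = g b" by auto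
  then have "p dvd a\<^sup>2 + b\<^sup>2 + 1"
    by (simp add: f_def g_def mod_eq_dvd_iff algebra_simps)
  with ab that show ?thesis by (auto simp: I_def)
qed

text \<open>Reduce the four bases modulo \<open>m\<close> to \<open>w, x, y, z\<close>. Their squares add up to some \<open>m * r\<close> with
\<open>r \<le> m\<close>, and Euler's identity writes \<open>(m * p) * (m * r)\<close> as four squares whose bases are all
divisible by \<open>m\<close>; dividing by \<open>m\<^sup>2\<close> leaves \<open>r * p\<close>. The extreme cases \<open>r = 0\<close> (all residues
vanish) and \<open>r = m\<close> (all residues are \<open>m / 2\<close> in absolute value) would make \<open>m\<close> a divisor of the
prime \<open>p\<close>.\<close>

lemma sum_of_four_squares_descent:
  fixes m p :: int
  assumes p: "prime p" and m: "1 < m" "m < p" and s: "sum_of_four_squares (m * p)"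
  shows "\<exists>r. 0 < r \<and> r < m \<and> sum_of_four_squares (r * p)"
proof -
  obtain a b c d where abcd: "m * p = a\<^sup>2 + b\<^sup>2 + c\<^sup>2 + d\<^sup>2" using s by (auto simp: sum_of_four_squares_def)
  have m0: "m > 0" using m by simp
  have not_dvd: "\<not> m dvd p"
  proof
    assume "m dvd p"
    with p m show False by (simp add: prime_int_iff) (metis less_imp_le less_irrefl m0)
  qed
  obtain w where w: "m dvd a - w" "2 * \<bar>w\<bar> \<le> m" using centred_residue[OF m0] by blast
  obtain x where x: "m dvd b - x" "2 * \<bar>x\<bar> \<le> m" using centred_residue[OF m0] by blast
  obtain y where y: "m dvd c - y" "2 * \<bar>y\<bar> \<le> m" using centred_residue[OF m0] by blast
  obtain z where z: "m dvd d - z" "2 * \<bar>z\<bar> \<le> m" using centred_residue[OF m0] by blast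
  obtain a' b' c' d' where q: "a = w + m * a'" "b = x + m * b'" "c = y + m * c'" "d = z + m * d'"
    using w(1) x(1) y(1) z(1) by (auto simp: dvd_def algebra_simps eq_diff_eq)
  \<comment> \<open>This is the quotient of \<open>w\<^sup>2 + x\<^sup>2 + y\<^sup>2 + z\<^sup>2\<close> by \<open>m\<close>, read off from expanding \<open>m * p\<close>.\<close>
  define r where "r = p - 2 * (w*a' + x*b' + y*c' + z*d') - m * (a'\<^sup>2 + b'\<^sup>2 + c'\<^sup>2 + d'\<^sup>2)"
  have r: "w\<^sup>2 + x\<^sup>2 + y\<^sup>2 + z\<^sup>2 = m * r"
    using abcd unfolding q r_def by algebra
  have sq: "4 * t\<^sup>2 \<le> m\<^sup>2" if "2 * \<bar>t\<bar> \<le> m" for t :: int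
    using power_mono[OF that, of 2] by (simp add: power_mult_distrib)
  have sqe: "2 * \<bar>t\<bar> = m" if "4 * t\<^sup>2 = m\<^sup>2" for t :: int
  proof -
    have "(2 * \<bar>t\<bar>)\<^sup>2 = m\<^sup>2" using that by (simp add: power_mult_distrib)
    then show ?thesis using m0 by (metis abs_of_pos abs_ge_zero mult_nonneg_nonneg power2_eq_iff_nonneg zero_le_numeral less_imp_le)
  qed
  note le = sq[OF w(2)] sq[OF x(2)] sq[OF y(2)] sq[OF z(2)]
  have "m * r \<ge> 0" using r by (metis add_nonneg_nonneg zero_le_power2)
  then have r0: "r \<ge> 0" using m0 by (simp add: zero_le_mult_iff)
  have "m * r \<le> m * m" using le r by (simp add: power2_eq_square)
  then have rm: "r \<le> m" using m0 by simp
  have "r \<noteq> 0"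
  proof
    assume "r = 0"
    with r have "w = 0 \<and> x = 0 \<and> y = 0 \<and> z = 0"
      by (simp add: add_nonneg_eq_0_iff)
    then have "p = m * (a'\<^sup>2 + b'\<^sup>2 + c'\<^sup>2 + d'\<^sup>2)"
      using r_def \<open>r = 0\<close> by simp
    with not_dvd show False by (metis dvd_triv_left)
  qed
  moreover have "r \<noteq> m"
  proof
    assume "r = m"
    with r le have "4 * w\<^sup>2 = m\<^sup>2" "4 * x\<^sup>2 = m\<^sup>2" "4 * y\<^sup>2 = m\<^sup>2" "4 * z\<^sup>2 = m\<^sup>2"
      by (simp_all add: power2_eq_square)
    note e = this[THEN sqe]
    have "m dvd 2 * t" if "2 * \<bar>t\<bar> = m" for t
      using that by (metis abs_mult abs_numeral dvd_abs_iff dvd_refl)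
    from e[THEN this] have "m dvd 2 * w * a' + 2 * x * b' + 2 * y * c' + 2 * z * d'"
      by (intro dvd_add) (simp_all add: dvd_mult2)
    then obtain u where u: "2 * w * a' + 2 * x * b' + 2 * y * c' + 2 * z * d' = m * u" by auto
    have "p = m * (u + 1 + (a'\<^sup>2 + b'\<^sup>2 + c'\<^sup>2 + d'\<^sup>2))"
      using u r_def \<open>r = m\<close> by (simp add: distrib_left mult.assoc)
    with not_dvd show False by (metis dvd_triv_left)
  qed
  moreover have "sum_of_four_squares (r * p)"
  proof -
    define s where "s = a'*w + b'*x + c'*y + d'*z + r"
    define t where "t = a'*x - b'*w + c'*z - d'*y"
    define u where "u = a'*y - c'*w + d'*x - b'*z"
    define v where "v = a'*z - d'*w + b'*y - c'*x"
    have "(m * p) * (m * r) = (m * s)\<^sup>2 + (m * t)\<^sup>2 + (m * u)\<^sup>2 + (m * v)\<^sup>2"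
    proof -
      have "a*w + b*x + c*y + d*z = m * s"
        unfolding s_def q distrib_left r[symmetric] by algebra
      moreover have "a*x - b*w + c*z - d*y = m * t" unfolding t_def q by algebra
      moreover have "a*y - c*w + d*x - b*z = m * u" unfolding u_def q by algebra
      moreover have "a*z - d*w + b*y - c*x = m * v" unfolding v_def q by algebra
      ultimately show ?thesis unfolding abcd r[symmetric] euler_four_squares by simp
    qed
    then have "m\<^sup>2 * (r * p) = m\<^sup>2 * (s\<^sup>2 + t\<^sup>2 + u\<^sup>2 + v\<^sup>2)"
      by algebra
    then show ?thesis using m0 unfolding sum_of_four_squares_def by auto
  qed
  ultimately show ?thesis using r0 rm by (intro exI[of _ r]) auto
qed

text \<open>The multiple \<open>m * p = a\<^sup>2 + b\<^sup>2 + 1\<close> with \<open>m < p\<close> starts the descent, which stops at \<open>1 * p\<close>.\<close>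

lemma sum_of_four_squares_prime:
  fixes p :: int
  assumes "prime p"
  shows "sum_of_four_squares p"
proof (cases "odd p")
  case False
  then have "p = 2" using prime_odd_int[OF assms] prime_gt_1_int[OF assms] by linarith
  then have "p = 1\<^sup>2 + 1\<^sup>2 + 0\<^sup>2 + 0\<^sup>2" by simp
  then show ?thesis unfolding sum_of_four_squares_def by blast
next
  case True
  have p0: "p > 1" using assms prime_gt_1_int by blast
  have desc: "sum_of_four_squares p" if "0 < m" "m < p" "sum_of_four_squares (m * p)" for m
    using that
  proof (induction "nat m" arbitrary: m rule: less_induct)
    case less
    show ?case
    proof (cases "m = 1")
      case False
      then obtain r where "0 < r" "r < m" "sum_of_four_squares (r * p)"
        using sum_of_four_squares_descent[OF assms, of m] less.prems by auto
      with less.hyps[of r] less.prems show ?thesis by auto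
    qed (use less.prems in simp)
  qed
  obtain a b where ab: "0 \<le> a" "2 * a < p" "0 \<le> b" "2 * b < p" "p dvd a\<^sup>2 + b\<^sup>2 + 1"
    using prime_dvd_two_squares_plus_one[OF assms True] .
  then obtain m where m: "a\<^sup>2 + b\<^sup>2 + 1 = m * p" by (metis dvd_def mult.commute)
  have "4 * a\<^sup>2 < p\<^sup>2" "4 * b\<^sup>2 < p\<^sup>2"
    using ab power_strict_mono[of "2 * a" p 2] power_strict_mono[of "2 * b" p 2]
    by (simp_all add: power_mult_distrib)
  moreover have "p\<^sup>2 \<ge> 2\<^sup>2" using p0 by (intro power_mono) auto
  ultimately have "m * p < p * p" unfolding m[symmetric] by (simp add: power2_eq_square)
  then have "m < p" using p0 by simp
  moreover have "m * p > 0" unfolding m[symmetric] by (smt (verit) zero_le_power2)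
  then have "m > 0" using p0 by (simp add: zero_less_mult_iff)
  moreover have "sum_of_four_squares (m * p)" unfolding m[symmetric] sum_of_four_squares_def
    by (rule exI[of _ a], rule exI[of _ b], rule exI[of _ 1], rule exI[of _ 0]) simp
  ultimately show ?thesis by (intro desc)
qed

theorem lagrange_four_squares: "sum_of_four_squares (int n)"
proof (induction n rule: less_induct)
  case (less n)
  consider "n = 0" | "n = 1" | "n > 1" by linarith
  then show ?case
  proof cases
    case 3
    then obtain p where p: "prime p" "p dvd n" by (metis prime_factor_nat less_irrefl)
    then obtain k where k: "n = p * k" by auto
    have "k < n" using 3 k prime_gt_1_nat[OF p(1)] by (cases "k = 0") auto
    then show ?thesis using less.IH[of k] sum_of_four_squares_prime[of "int p"] p k by (auto intro: sum_of_four_squares_mult)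
  next
    case 2
    then have "int n = 1\<^sup>2 + 0\<^sup>2 + 0\<^sup>2 + 0\<^sup>2" by simp
    then show ?thesis unfolding sum_of_four_squares_def by blast
  next
    case 1
    then have "int n = 0\<^sup>2 + 0\<^sup>2 + 0\<^sup>2 + 0\<^sup>2" by simp
    then show ?thesis unfolding sum_of_four_squares_def by blast
  qed
qed

section \<open>A recursively enumerable graph\<close>

lemma rec_eval_Proj: "i < length xs \<Longrightarrow> y = xs ! i \<Longrightarrow> rec_eval (Proj i) xs y"
  using rec_eval.proj by simp

lemma rec_eval_Comp1: "rec_eval g xs y \<Longrightarrow> rec_eval f [y] z \<Longrightarrow> rec_eval (Comp f [g]) xs z"
  by (intro rec_eval.comp[where ys = "[y]"]) auto

lemma rec_eval_Comp2:
  "rec_eval g xs y \<Longrightarrow> rec_eval g' xs y' \<Longrightarrow> rec_eval f [y, y'] z \<Longrightarrow> rec_eval (Comp f [g, g']) xs z"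
  by (intro rec_eval.comp[where ys = "[y, y']"]) auto

definition rec_add :: recf where
  "rec_add = PrimRec (Proj 0) (Comp Succ [Proj 1])"

definition rec_pred :: recf where
  "rec_pred = PrimRec Zero (Proj 0)"

text \<open>Truncated subtraction with the arguments exchanged: the recursion runs over the number to be
subtracted, which therefore comes first.\<close>

definition rec_rsub :: recf where
  "rec_rsub = PrimRec (Proj 0) (Comp rec_pred [Proj 1])"

lemma rec_eval_add: "rec_eval rec_add [a, b] (a + b)"
  unfolding rec_add_def
proof (induction a)
  case (Suc a)
  show ?case
    by (rule rec_eval.primrec_Suc[OF Suc])
      (auto intro!: rec_eval_Comp1 rec_eval_Proj rec_eval.succ)
qed (auto intro!: rec_eval.primrec_0 rec_eval_Proj)

lemma rec_eval_pred: "rec_eval rec_pred [a] (a - 1)"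
  unfolding rec_pred_def
proof (induction a)
  case (Suc a)
  show ?case by (rule rec_eval.primrec_Suc[OF Suc]) (auto intro!: rec_eval_Proj)
qed (auto intro!: rec_eval.primrec_0 rec_eval.zero)

lemma rec_eval_rsub: "rec_eval rec_rsub [a, b] (b - a)"
  unfolding rec_rsub_def
proof (induction a)
  case (Suc a)
  have "rec_eval (Comp rec_pred [Proj 1]) [a, b - a, b] (b - a - 1)"
    by (rule rec_eval_Comp1[OF _ rec_eval_pred]) (simp add: rec_eval_Proj)
  then show ?case
    using rec_eval.primrec_Suc[OF Suc] by simp
qed (auto intro!: rec_eval.primrec_0 rec_eval_Proj)

text \<open>The set is the domain of an unbounded search for a zero of a function that ignores the search
variable and returns the distance between \<open>y\<close> and \<open>f (2 * k) + 1\<close>. The search stops at once if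
the distance is 0 and never otherwise. Nothing is claimed for \<open>k = 0\<close>, where the program for
\<open>f\<close> may diverge.\<close>

lemma recursively_enumerable_Suc_double_graph:
  assumes "computable_on_positive f"
  obtains M where "recursively_enumerable 2 M"
    "\<And>k y. k \<ge> 1 \<Longrightarrow> [k, y] \<in> M \<longleftrightarrow> y = Suc (f (2 * k))"
proof -
  obtain r where r: "has_arity r 1" "\<And>n. n \<ge> 1 \<Longrightarrow> rec_eval r [n] (f n)"
    using assms by (auto simp: computable_on_positive_def)
  \<comment> \<open>In both programs entry 0 of the argument list is the search variable, 1 is \<open>k\<close>, 2 is \<open>y\<close>.\<close>
  define g where "g = Comp Succ [Comp r [Comp rec_add [Proj 1, Proj 1]]]"
  define d where "d = Comp rec_add [Comp rec_rsub [g, Proj 2], Comp rec_rsub [Proj 2, g]]"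
  define M where "M = {a. length a = 2 \<and> (\<exists>y. rec_eval (Mu d) a y)}"
  have "has_arity (Mu d) 2"
    using r(1) by (simp add: d_def g_def rec_add_def rec_rsub_def rec_pred_def)
  then have "recursively_enumerable 2 M" unfolding recursively_enumerable_def M_def by blast
  moreover have "[k, y] \<in> M \<longleftrightarrow> y = Suc (f (2 * k))" if "k \<ge> 1" for k y
  proof -
    define h where "h = Suc (f (2 * k))"
    have "rec_eval (Comp rec_add [Proj 1, Proj 1]) [j, k, y] (2 * k)" for j
      unfolding mult_2 by (rule rec_eval_Comp2[OF _ _ rec_eval_add]) (simp_all add: rec_eval_Proj)
    then have g: "rec_eval g [j, k, y] h" for j
      unfolding g_def h_def using that r(2)[of "2 * k"]
      by (auto intro!: rec_eval_Comp1 rec_eval.succ)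
    have y: "rec_eval (Proj 2) [j, k, y] y" for j by (simp add: rec_eval_Proj)
    have d: "rec_eval d [j, k, y] ((y - h) + (h - y))" for j
      unfolding d_def
      by (intro rec_eval_Comp2[OF _ _ rec_eval_add] rec_eval_Comp2[OF _ _ rec_eval_rsub] g y)
    have "(\<exists>z. rec_eval (Mu d) [k, y] z) \<longleftrightarrow> y = h"
    proof
      assume "\<exists>z. rec_eval (Mu d) [k, y] z"
      then obtain z where "rec_eval d [z, k, y] 0" by (auto elim: rec_eval.cases)
      from rec_eval_deterministic[OF this d] show "y = h" by simp
    next
      assume "y = h"
      then have "rec_eval d [0, k, y] 0" using d[of 0] by simp
      then have "rec_eval (Mu d) [k, y] 0" by (intro rec_eval.mu) auto
      then show "\<exists>z. rec_eval (Mu d) [k, y] z" by blast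
    qed
    then show ?thesis by (simp add: M_def h_def)
  qed
  ultimately show ?thesis by (rule that)
qed

section \<open>Systems that evaluate polynomials\<close>

text \<open>Polynomial functions of the first \<open>N\<close> entries, built from operations that one equation can
express. Subtraction is primitive because \<open>p - q = z\<close> is the equation \<open>z + q = p\<close>; it also yields
zero and the negative constants.\<close>

inductive polyfun :: "nat \<Rightarrow> (int list \<Rightarrow> int) \<Rightarrow> bool" for N where
  var: "i < N \<Longrightarrow> polyfun N (\<lambda>v. v ! i)"
| one: "polyfun N (\<lambda>v. 1)"
| diff: "polyfun N p \<Longrightarrow> polyfun N q \<Longrightarrow> polyfun N (\<lambda>v. p v - q v)"
| mult: "polyfun N p \<Longrightarrow> polyfun N q \<Longrightarrow> polyfun N (\<lambda>v. p v * q v)"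

lemma polyfun_zero: "polyfun N (\<lambda>v. 0)"
  using polyfun.diff[OF polyfun.one polyfun.one] by simp

lemma polyfun_add:
  assumes "polyfun N p" "polyfun N q"
  shows "polyfun N (\<lambda>v. p v + q v)"
  using polyfun.diff[OF assms(1) polyfun.diff[OF polyfun_zero assms(2)]] by simp

lemma polyfun_const: "polyfun N (\<lambda>v. c)"
proof (induction c rule: int_induct[where k = 0])
  case base
  show ?case by (rule polyfun_zero)
next
  case (step1 i)
  then show ?case by (intro polyfun_add polyfun.one)
next
  case (step2 i)
  then show ?case by (intro polyfun.diff polyfun.one)
qed

lemma polyfun_power: "polyfun N p \<Longrightarrow> polyfun N (\<lambda>v. p v ^ e)"
  by (induction e) (auto intro: polyfun.intros)

lemma polyfun_sum: "(\<And>i. i \<in> A \<Longrightarrow> polyfun N (p i)) \<Longrightarrow> polyfun N (\<lambda>v. \<Sum>i\<in>A. p i v)"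
  by (induction A rule: infinite_finite_induct) (auto intro: polyfun_zero polyfun_add)

lemma polyfun_prod: "(\<And>i. i \<in> A \<Longrightarrow> polyfun N (p i)) \<Longrightarrow> polyfun N (\<lambda>v. \<Prod>i\<in>A. p i v)"
  by (induction A rule: infinite_finite_induct) (auto intro: polyfun.intros)

lemma polyfun_mpoly_eval: "mpoly_vars W \<subseteq> {..<N} \<Longrightarrow> polyfun N (mpoly_eval W)"
  unfolding mpoly_eval_def
  by (intro polyfun_sum polyfun_prod polyfun.mult polyfun_const polyfun_power polyfun.var)
    (auto simp: mpoly_vars_def)

lemma polyfun_append:
  assumes "polyfun N p" "N \<le> length v"
  shows "p (v @ w) = p v"
  using assms by (induction rule: polyfun.induct) (auto simp: nth_append)

lemma satisfies_append:
  assumes "e \<in> E N" "N \<le> length v"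
  shows "satisfies (v @ w) e \<longleftrightarrow> satisfies v e"
  using assms by (auto simp: E_def nth_append)

lemma E_mono: "N \<le> N' \<Longrightarrow> E N \<subseteq> E N'"
  by (fastforce simp: E_def)

text \<open>A system \<open>S\<close> on \<open>N\<close> given and \<open>c\<close> new variables computes \<open>p\<close> if every assignment \<open>v\<close> of the
given variables extends to exactly one solution, by \<open>g v\<close>, and variable \<open>j\<close> then has the value
\<open>p v\<close>. Uniqueness keeps the number of solutions under control when systems are put together.\<close>

definition computes ::
  "nat \<Rightarrow> (int list \<Rightarrow> int) \<Rightarrow> nat \<Rightarrow> equation set \<Rightarrow> nat \<Rightarrow> (int list \<Rightarrow> int list) \<Rightarrow> bool" where
  "computes N p c S j g \<longleftrightarrow> j < N + c \<and> S \<subseteq> E (N + c) \<and>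
     (\<forall>v. length v = N \<longrightarrow> length (g v) = c \<and> (v @ g v) ! j = p v \<and>
        (\<forall>w. length w = c \<longrightarrow> (\<forall>e\<in>S. satisfies (v @ w) e) \<longleftrightarrow> w = g v))"

lemma computesD:
  assumes "computes N p c S j g"
  shows "j < N + c" "S \<subseteq> E (N + c)"
    and "length v = N \<Longrightarrow> length (g v) = c"
    and "length v = N \<Longrightarrow> (v @ g v) ! j = p v"
    and "length v = N \<Longrightarrow> length w = c \<Longrightarrow> (\<forall>e\<in>S. satisfies (v @ w) e) \<longleftrightarrow> w = g v"
  using assms unfolding computes_def by blast+

text \<open>The second system treats the auxiliary variables of the first as given, so no variable ever has
to be renamed; one more variable receives the result of the operation.\<close>

lemma computes_binop:
  assumes p: "computes N p c S j g" and q: "computes (N + c) q c' S' j' g'"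
    and q_eq: "\<And>v w. length v = N \<Longrightarrow> q (v @ w) = q v"
    and e: "e \<in> E (N + c + c' + 1)"
    and sat: "\<And>x t. length x = N + c + c' \<Longrightarrow> satisfies (x @ [t]) e \<longleftrightarrow> t = h (x ! j) (x ! j')"
  shows "computes N (\<lambda>v. h (p v) (q v)) (c + c' + 1) (S \<union> S' \<union> {e}) (N + c + c')
           (\<lambda>v. g v @ g' (v @ g v) @ [h (p v) (q v)])"
  unfolding computes_def
proof (intro conjI allI impI)
  show "N + c + c' < N + (c + c' + 1)" by simp
  have S: "S \<subseteq> E (N + c)" and S': "S' \<subseteq> E (N + c + c')"
    using p q by (auto simp: computes_def)
  then show "S \<union> S' \<union> {e} \<subseteq> E (N + (c + c' + 1))"
    using e E_mono[of "N + c" "N + (c + c' + 1)"] E_mono[of "N + c + c'" "N + (c + c' + 1)"]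
    by (auto simp: add.assoc)
  fix v :: "int list" assume v: "length v = N"
  have g: "length (g v) = c" and gp: "(v @ g v) ! j = p v" and j: "j < N + c"
    and w: "\<And>w. length w = c \<Longrightarrow> (\<forall>e\<in>S. satisfies (v @ w) e) \<longleftrightarrow> w = g v"
    using computesD[OF p] v by blast+
  have vg: "length (v @ g v) = N + c" using v g by simp
  have g': "length (g' (v @ g v)) = c'" and gq: "(v @ g v @ g' (v @ g v)) ! j' = q (v @ g v)"
    and w': "\<And>w. length w = c' \<Longrightarrow> (\<forall>e\<in>S'. satisfies (v @ g v @ w) e) \<longleftrightarrow> w = g' (v @ g v)"
    using computesD(3-5)[OF q vg] by (simp_all only: append_assoc)
  show "length (g v @ g' (v @ g v) @ [h (p v) (q v)]) = c + c' + 1"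
    by (simp add: g g')
  show "(v @ g v @ g' (v @ g v) @ [h (p v) (q v)]) ! (N + c + c') = h (p v) (q v)"
    using nth_append_length[of "v @ g v @ g' (v @ g v)"] v by (simp add: g g' add.assoc)
  fix w :: "int list" assume len: "length w = c + c' + 1"
  define w1 w2 t where "w1 = take c w" and "w2 = take c' (drop c w)" and "t = w ! (c + c')"
  have w_eq: "w = w1 @ w2 @ [t]"
  proof -
    have "w = take (c + c') w @ [t]"
      using len by (simp add: t_def take_Suc_conv_app_nth[symmetric])
    then show ?thesis by (simp add: w1_def w2_def take_add)
  qed
  have l1: "length w1 = c" and l2: "length w2 = c'" using len by (auto simp: w1_def w2_def)
  have "(\<forall>e'\<in>S \<union> S' \<union> {e}. satisfies (v @ w) e') \<longleftrightarrow>
      (\<forall>e\<in>S. satisfies (v @ w1) e) \<and> (\<forall>e\<in>S'. satisfies (v @ w1 @ w2) e) \<and>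
      satisfies ((v @ w1 @ w2) @ [t]) e"
  proof -
    have "satisfies (v @ w) e' \<longleftrightarrow> satisfies (v @ w1) e'" if "e' \<in> S" for e'
      using satisfies_append[of e' "N + c" "v @ w1" "w2 @ [t]"] that S v l1 w_eq by auto
    moreover have "satisfies (v @ w) e' \<longleftrightarrow> satisfies (v @ w1 @ w2) e'" if "e' \<in> S'" for e'
      using satisfies_append[of e' "N + c + c'" "v @ w1 @ w2" "[t]"] that S' v l1 l2 w_eq by auto
    ultimately show ?thesis using w_eq by auto
  qed
  also have "\<dots> \<longleftrightarrow> w1 = g v \<and> w2 = g' (v @ g v) \<and> satisfies ((v @ w1 @ w2) @ [t]) e"
    using w[OF l1] w'[OF l2] by auto
  also have "\<dots> \<longleftrightarrow> w1 = g v \<and> w2 = g' (v @ g v) \<and> t = h (p v) (q v)"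
  proof -
    have "(v @ g v @ g' (v @ g v)) ! j = p v" 
      using gp j v g by (metis append.assoc length_append nth_append)
    moreover have "(v @ g v @ g' (v @ g v)) ! j' = q v" using gq q_eq[OF v] by simp
    ultimately show ?thesis using sat[of "v @ w1 @ w2" t] v l1 l2 by auto
  qed
  also have "\<dots> \<longleftrightarrow> w = g v @ g' (v @ g v) @ [h (p v) (q v)]"
    unfolding w_eq using l1 l2 g g' by auto
  finally show "(\<forall>e\<in>S \<union> S' \<union> {e}. satisfies (v @ w) e) \<longleftrightarrow> w = g v @ g' (v @ g v) @ [h (p v) (q v)]" .
qed

text \<open>The number \<open>N\<close> of given variables is arbitrary above \<open>N\<^sub>0\<close> so that the induction hypothesis for the
second operand applies after the auxiliary variables of the first have been added.\<close>

lemma polyfun_computes: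
  assumes "polyfun N\<^sub>0 p" "N\<^sub>0 \<le> N"
  shows "\<exists>c S j g. computes N p c S j g"
  using assms
proof (induction arbitrary: N rule: polyfun.induct)
  case (var i)
  then have "computes N (\<lambda>v. v ! i) 0 {} i (\<lambda>v. [])" by (simp add: computes_def)
  then show ?case by blast
next
  case one
  have "length w = Suc 0 \<longleftrightarrow> (\<exists>t. w = [t])" for w :: "int list" by (auto simp: length_Suc_conv)
  then have "computes N (\<lambda>v. 1) 1 {One N} N (\<lambda>v. [1])"
    by (auto simp: computes_def E_def)
  then show ?case by blast
next
  case (diff p q)
  obtain c S j g where p: "computes N p c S j g" using diff by blast
  obtain c' S' j' g' where q: "computes (N + c) q c' S' j' g'" using diff.IH(2)[of "N + c"] diff.prems by auto
  have jj: "j < N + c" "j' < N + c + c'" using p q by (auto simp: computes_def)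
  have "computes N (\<lambda>v. p v - q v) (c + c' + 1) (S \<union> S' \<union> {Add (N + c + c') j' j}) (N + c + c')
           (\<lambda>v. g v @ g' (v @ g v) @ [p v - q v])"
    using jj diff.prems
    by (intro computes_binop[OF p q])
       (auto simp: E_def nth_append polyfun_append[OF diff.hyps(2)])
  then show ?case by blast
next
  case (mult p q)
  obtain c S j g where p: "computes N p c S j g" using mult by blast
  obtain c' S' j' g' where q: "computes (N + c) q c' S' j' g'" using mult.IH(2)[of "N + c"] mult.prems by auto
  have jj: "j < N + c" "j' < N + c + c'" using p q by (auto simp: computes_def)
  have "computes N (\<lambda>v. p v * q v) (c + c' + 1) (S \<union> S' \<union> {Mul j j' (N + c + c')}) (N + c + c')
           (\<lambda>v. g v @ g' (v @ g v) @ [p v * q v])"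
    using jj mult.prems
    by (intro computes_binop[OF p q])
       (auto simp: E_def nth_append polyfun_append[OF mult.hyps(2)])
  then show ?case by blast
qed

text \<open>All variables beyond those needed for \<open>p\<close> form a chain with the values \<open>1, 2, 3, \<dots>\<close>. Its \<open>k\<close>th
member pins the first variable to \<open>k\<close>, while the rest of the chain merely fills the system up to
exactly \<open>n\<close> variables without adding solutions. Thus the value \<open>k\<close> costs \<open>k\<close> variables, on top of
a number \<open>N + c\<close> that does not depend on \<open>k\<close>.\<close>

lemma system_for_zeros:
  assumes comp: "computes N p c S j g" and "N \<ge> 1" "k \<ge> 1" "N + c + k \<le> n"
  obtains T where "T \<subseteq> E n"
    "solutions n T = (\<lambda>v. v @ g v @ map (\<lambda>i. int i + 1) [0..<n - (N + c)]) `
       {v. length v = N \<and> v ! 0 = int k \<and> p v = 0}"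
proof -
  define b L where "b = N + c" and "L = n - b"
  define C where "C = insert (One b) ((\<lambda>i. Add (b + i) b (b + Suc i)) ` {..<L - 1})"
  \<comment> \<open>\<open>Add j j j\<close> says that variable \<open>j\<close>, the value of \<open>p\<close>, is zero; the last equation then says that the \<open>k\<close>th chain member equals variable 0.\<close>
  define T where "T = S \<union> {Add j j j} \<union> C \<union> {Add (b + (k - 1)) j 0}"
  have L: "k \<le> L" "n = b + L" using assms by (auto simp: L_def b_def)
  have S: "S \<subseteq> E b" and j: "j < b" using comp by (auto simp: computes_def b_def)
  have "S \<subseteq> E n" using S E_mono[of b n] L by auto
  then have "T \<subseteq> E n" using j assms L by (auto simp: T_def C_def E_def)
  moreover have chain: "(\<forall>e\<in>C. satisfies (y @ t) e) \<longleftrightarrow> t = map (\<lambda>i. int i + 1) [0..<L]"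
    if y: "length y = b" and t: "length t = L" for y t
  proof -
    have "(\<forall>e\<in>C. satisfies (y @ t) e) \<longleftrightarrow> t ! 0 = 1 \<and> (\<forall>i<L - 1. t ! i + t ! 0 = t ! Suc i)"
      using y by (auto simp: C_def nth_append)
    also have "\<dots> \<longleftrightarrow> (\<forall>i<L. t ! i = int i + 1)"
    proof
      assume h: "t ! 0 = 1 \<and> (\<forall>i<L - 1. t ! i + t ! 0 = t ! Suc i)"
      have "t ! i = int i + 1" if "i < L" for i
        using that
      proof (induction i)
        case (Suc i)
        then have "i < L - 1" by simp
        with Suc h show ?case by force
      qed (use h in simp)
      then show "\<forall>i<L. t ! i = int i + 1" by simp
    qed (use L assms in auto)
    also have "\<dots> \<longleftrightarrow> t = map (\<lambda>i. int i + 1) [0..<L]"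
      using t by (simp add: list_eq_iff_nth_eq)
    finally show ?thesis .
  qed
  have iff: "(\<forall>e\<in>T. satisfies (v @ w @ t) e) \<longleftrightarrow>
      w = g v \<and> t = map (\<lambda>i. int i + 1) [0..<L] \<and> p v = 0 \<and> v ! 0 = int k"
    if v: "length v = N" and w: "length w = c" and t: "length t = L" for v w t
  proof -
    have gS: "(\<forall>e\<in>S. satisfies (v @ w) e) \<longleftrightarrow> w = g v" and gp: "(v @ g v) ! j = p v"
      using comp v w by (auto simp: computes_def)
    have "satisfies (v @ w @ t) e \<longleftrightarrow> satisfies (v @ w) e" if "e \<in> S" for e
      using satisfies_append[of e b "v @ w" t] that S v w by (auto simp: b_def)
    then have S_iff: "(\<forall>e\<in>S. satisfies (v @ w @ t) e) \<longleftrightarrow> w = g v" using gS by simp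
    have C_iff: "(\<forall>e\<in>C. satisfies (v @ w @ t) e) \<longleftrightarrow> t = map (\<lambda>i. int i + 1) [0..<L]"
      using chain[of "v @ w" t] v w t by (simp add: b_def)
    have nths: "(v @ w @ t) ! j = (v @ w) ! j" "(v @ w @ t) ! (b + (k - 1)) = t ! (k - 1)"
        "(v @ w @ t) ! 0 = v ! 0"
      using j v w assms(2) by (auto simp: b_def nth_append)
    show ?thesis
      using S_iff C_iff nths gp L assms(3) by (auto simp: T_def ball_Un)
  qed
  have "solutions n T = (\<lambda>v. v @ g v @ map (\<lambda>i. int i + 1) [0..<L]) `
       {v. length v = N \<and> v ! 0 = int k \<and> p v = 0}" (is "_ = ?F ` ?Z")
  proof (intro set_eqI iffI)
    fix x assume x: "x \<in> solutions n T"
    define v w t where "v = take N x" and "w = take c (drop N x)" and "t = drop (N + c) x"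
    have lens: "length v = N" "length w = c" "length t = L"
      using x L by (auto simp: solutions_def v_def w_def t_def b_def)
    have "x = v @ w @ t"
      by (simp add: v_def w_def t_def) (metis append_take_drop_id drop_drop add.commute)
    with x iff[OF lens] lens show "x \<in> ?F ` ?Z" by (auto simp: solutions_def)
  next
    fix x assume "x \<in> ?F ` ?Z"
    then obtain v where v: "v \<in> ?Z" "x = ?F v" by blast
    moreover have "length (g v) = c" using comp v by (auto simp: computes_def)
    ultimately show "x \<in> solutions n T"
      using iff[of v "g v" "map (\<lambda>i. int i + 1) [0..<L]"] L by (auto simp: solutions_def b_def)
  qed
  ultimately show ?thesis using that by (simp add: L_def b_def)
qed

section \<open>From natural numbers to integers\<close>

lemma four_squares_family:
  "\<exists>q :: nat \<Rightarrow> int. int n = (\<Sum>t<4. (q t)\<^sup>2)"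
proof -
  obtain a b c d where "int n = a\<^sup>2 + b\<^sup>2 + c\<^sup>2 + d\<^sup>2"
    using lagrange_four_squares unfolding sum_of_four_squares_def by blast
  then have "int n = (\<Sum>t<4. (([a, b, c, d] ! t))\<^sup>2)" by (simp add: eval_nat_numeral)
  then show ?thesis by blast
qed

text \<open>Moves a problem about natural numbers to the integers. Entry 0 is the parameter, entries
\<open>1, \<dots>, m\<close> are the unknowns of \<open>W\<close>, and the remaining \<open>4 * m\<close> entries are grouped into four
bases of squares per unknown. The sum of squares vanishes iff \<open>W\<close> does and each unknown is the sum
of its four squares, hence nonnegative.\<close>

definition lifted_poly :: "nat \<Rightarrow> int_mpoly \<Rightarrow> int list \<Rightarrow> int" where
  "lifted_poly m W v = (mpoly_eval W v)\<^sup>2 +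
     (\<Sum>i<m. (v ! Suc i - (\<Sum>t<4. (v ! (Suc m + 4 * i + t))\<^sup>2))\<^sup>2)"

lemma polyfun_lifted_poly:
  assumes "mpoly_vars W \<subseteq> {..<Suc m}"
  shows "polyfun (5 * m + 1) (lifted_poly m W)"
  unfolding lifted_poly_def
  using assms
  by (intro polyfun_add polyfun_power polyfun_sum polyfun.diff polyfun_mpoly_eval polyfun.var) auto

lemma lifted_poly_eq_0_iff:
  "lifted_poly m W v = 0 \<longleftrightarrow>
     mpoly_eval W v = 0 \<and> (\<forall>i<m. v ! Suc i = (\<Sum>t<4. (v ! (Suc m + 4 * i + t))\<^sup>2))"
  unfolding lifted_poly_def
  by (subst add_nonneg_eq_0_iff) (auto simp: sum_nonneg sum_nonneg_eq_0_iff)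

lemma mpoly_eval_append:
  assumes "mpoly_vars W \<subseteq> {..<N}" "N \<le> length v"
  shows "mpoly_eval W (v @ w) = mpoly_eval W v"
  using polyfun_append[OF polyfun_mpoly_eval] assms .

text \<open>Lagrange's theorem supplies the four bases of squares for each unknown.\<close>

lemma ex_zero_lifted_poly:
  assumes W: "mpoly_vars W \<subseteq> {..<Suc m}" and x: "length x = m"
    and zero: "mpoly_eval W (map int (k # x)) = 0"
  shows "\<exists>v. length v = 5 * m + 1 \<and> v ! 0 = int k \<and> (\<forall>i<m. v ! Suc i = int (x ! i)) \<and>
           lifted_poly m W v = 0"
proof -
  have "\<forall>i. \<exists>q :: nat \<Rightarrow> int. int (x ! i) = (\<Sum>t<4. (q t)\<^sup>2)"
    by (intro allI four_squares_family)
  from choice[OF this] obtain q :: "nat \<Rightarrow> nat \<Rightarrow> int" where q: "\<And>i. int (x ! i) = (\<Sum>t<4. (q i t)\<^sup>2)" by blast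
  define v where "v = map int (k # x) @ map (\<lambda>j. q (j div 4) (j mod 4)) [0..<4 * m]"
  have "v ! (Suc m + 4 * i + t) = q i t" if "i < m" "t < 4" for i t
  proof -
    have "v ! (Suc m + 4 * i + t) = map (\<lambda>j. q (j div 4) (j mod 4)) [0..<4 * m] ! (4 * i + t)"
      using x by (simp add: v_def nth_append)
    also have "\<dots> = q i t" using that by simp
    finally show ?thesis .
  qed
  moreover have nat_part: "v ! Suc i = int (x ! i)" if "i < m" for i
    using x that by (simp add: v_def nth_append)
  moreover have "mpoly_eval W v = 0"
    unfolding v_def using zero x by (subst mpoly_eval_append[OF W]) auto
  ultimately have "lifted_poly m W v = 0"
    by (simp add: lifted_poly_eq_0_iff q)
  moreover have "length v = 5 * m + 1" "v ! 0 = int k" using x by (simp_all add: v_def)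
  ultimately show ?thesis using nat_part by blast
qed

text \<open>Conversely, an integer zero comes from a natural solution \<open>x\<close>, and all its entries are bounded
in terms of \<open>k\<close> and \<open>x\<close>, because \<open>\<bar>a\<bar> \<le> a\<^sup>2\<close> for each base \<open>a\<close> of a square. This is why lifting preserves finiteness.\<close>

lemma zero_lifted_polyD:
  assumes W: "mpoly_vars W \<subseteq> {..<Suc m}" and v: "length v = 5 * m + 1" "v ! 0 = int k"
    and zero: "lifted_poly m W v = 0"
  obtains x where "length x = m" "mpoly_eval W (map int (k # x)) = 0"
    "set v \<subseteq> {- (\<Sum>y\<leftarrow>k # x. int y)..(\<Sum>y\<leftarrow>k # x. int y)}"
proof -
  define x where "x = map nat (take m (drop 1 v))"
  define B where "B = (\<Sum>y\<leftarrow>k # x. int y)"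
  have sq: "v ! Suc i = (\<Sum>t<4. (v ! (Suc m + 4 * i + t))\<^sup>2)" if "i < m" for i
    using zero that by (simp add: lifted_poly_eq_0_iff)
  then have nonneg: "v ! Suc i \<ge> 0" if "i < m" for i
    using that by (simp add: sum_nonneg)
  have lx: "length x = m" using v by (simp add: x_def)
  have x_nth: "v ! Suc i = int (x ! i)" if "i < m" for i
    using that v nonneg[OF that] by (simp add: x_def)
  have "take (Suc m) v = map int (k # x)"
    using v lx x_nth by (intro nth_equalityI) (auto simp: nth_Cons split: nat.splits)
  then have v_eq: "v = map int (k # x) @ drop (Suc m) v" by (metis append_take_drop_id)
  have "mpoly_eval W (map int (k # x)) = mpoly_eval W v"
    by (subst v_eq, rule mpoly_eval_append[OF W, symmetric]) (use lx in simp)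
  then have "mpoly_eval W (map int (k # x)) = 0"
    using zero by (simp add: lifted_poly_eq_0_iff)
  moreover have le_B: "int y \<le> B" if "y \<in> set (k # x)" for y
    unfolding B_def using that by (intro member_le_sum_list) auto
  have "set v \<subseteq> {- B..B}"
  proof
    fix a assume "a \<in> set v"
    then obtain l where l: "l < 5 * m + 1" "a = v ! l" using v by (auto simp: in_set_conv_nth)
    consider "l = 0" | i where "i < m" "l = Suc i" | "l \<ge> Suc m"
      by (cases l) (auto simp: not_less_eq_eq linorder_not_less[symmetric])
    then show "a \<in> {- B..B}"
    proof cases
      case 1
      then show ?thesis using l v le_B[of k] by auto
    next
      case (2 i)
      then show ?thesis using l x_nth[of i] le_B[of "x ! i"] lx by auto
    next
      case 3
      \<comment> \<open>Entry \<open>l\<close> is base number \<open>t\<close> of the squares for unknown number \<open>i\<close>.\<close>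
      define i t where "i = (l - Suc m) div 4" and "t = (l - Suc m) mod 4"
      have "i < m" "t < 4" "l = Suc m + 4 * i + t" using 3 l by (auto simp: i_def t_def)
      then have "a\<^sup>2 \<le> v ! Suc i"
        unfolding sq[OF \<open>i < m\<close>] l(2)
        using member_le_sum[of t "{..<4}" "\<lambda>t. (v ! (Suc m + 4 * i + t))\<^sup>2"] by simp
      also have "\<dots> \<le> B" using x_nth[of i] le_B[of "x ! i"] lx \<open>i < m\<close> by auto
      finally have "\<bar>a\<bar>\<^sup>2 \<le> B" by simp
      moreover have "\<bar>a\<bar> \<le> \<bar>a\<bar>\<^sup>2" using self_le_power[of "\<bar>a\<bar>" 2] by (cases "a = 0") auto
      ultimately show ?thesis by auto
    qed
  qed
  ultimately show ?thesis using that lx unfolding B_def by blast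
qed

lemma finite_zeros_lifted_poly:
  assumes W: "mpoly_vars W \<subseteq> {..<Suc m}"
    and fin: "finite {x. length x = m \<and> mpoly_eval W (map int (k # x)) = 0}" (is "finite ?X")
  shows "finite {v. length v = 5 * m + 1 \<and> v ! 0 = int k \<and> lifted_poly m W v = 0}" (is "finite ?Z")
proof -
  let ?B = "\<lambda>x. \<Sum>y\<leftarrow>k # x. int y"
  have "?Z \<subseteq> (\<Union>x\<in>?X. {v. set v \<subseteq> {- ?B x..?B x} \<and> length v = 5 * m + 1})"
  proof
    fix v assume "v \<in> ?Z"
    then obtain x where "x \<in> ?X" "set v \<subseteq> {- ?B x..?B x}"
      using zero_lifted_polyD[OF W, of v k] by auto
    with \<open>v \<in> ?Z\<close> show "v \<in> (\<Union>x\<in>?X. {v. set v \<subseteq> {- ?B x..?B x} \<and> length v = 5 * m + 1})"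
      by blast
  qed
  then show ?thesis
    by (rule finite_subset) (intro finite_UN_I fin finite_lists_length_eq finite_atLeastAtMost_int)
qed

section \<open>Systems with large solutions\<close>

text \<open>The polynomial \<open>W\<close> of a finite-fold representation has the unknown \<open>y\<close> together with the
existentially quantified ones. For a fixed parameter \<open>k\<close> only \<open>y = h k\<close> occurs, so finiteness of
each fibre of the representation gives finiteness altogether.\<close>

lemma finite_system_with_large_solution:
  assumes ff: "finite_fold_diophantine 2 M"
    and M: "\<And>k y. k \<ge> 1 \<Longrightarrow> [k, y] \<in> M \<longleftrightarrow> y = h k"
  obtains k S x where "k \<ge> 1" "S \<subseteq> E (2 * k)" "finite (solutions (2 * k) S)"
    "x \<in> solutions (2 * k) S" "1 < 2 * k" "x ! 1 = int (h k)"
proof -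
  obtain m W where W: "mpoly_vars W \<subseteq> {..<2 + m}"
    and rep: "\<And>a. length a = 2 \<Longrightarrow>
      a \<in> M \<longleftrightarrow> (\<exists>x. length x = m \<and> mpoly_eval W (map int (a @ x)) = 0)"
    and fin: "\<And>a. length a = 2 \<Longrightarrow>
      finite {x. length x = m \<and> mpoly_eval W (map int (a @ x)) = 0}"
    using ff unfolding finite_fold_diophantine_def by blast
  have W': "mpoly_vars W \<subseteq> {..<Suc (Suc m)}" using W by simp
  define N where "N = 5 * Suc m + 1"
  define P where "P = lifted_poly (Suc m) W"
  have "polyfun N P" using polyfun_lifted_poly[OF W'] by (simp add: N_def P_def)
  then obtain c S j g where comp: "computes N P c S j g" using polyfun_computes by blast
  \<comment> \<open>From this \<open>k\<close> on, \<open>2 * k\<close> variables suffice for the polynomial and for the chain up to \<open>k\<close>.\<close>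
  define k where "k = N + c"
  have k: "k \<ge> 1" "N \<ge> 1" "N + c + k \<le> 2 * k" by (auto simp: k_def N_def)
  define Z where "Z = {v. length v = N \<and> v ! 0 = int k \<and> P v = 0}"
  obtain T where T: "T \<subseteq> E (2 * k)"
    "solutions (2 * k) T = (\<lambda>v. v @ g v @ map (\<lambda>i. int i + 1) [0..<2 * k - (N + c)]) ` Z"
    using system_for_zeros[OF comp k(2,1,3)] unfolding Z_def .
  have X: "{x. length x = Suc m \<and> mpoly_eval W (map int (k # x)) = 0} =
      (\<lambda>x. h k # x) ` {x. length x = m \<and> mpoly_eval W (map int ([k, h k] @ x)) = 0}" (is "?L = ?R")
  proof -
    have "y = h k" if "length x = m" "mpoly_eval W (map int ([k, y] @ x)) = 0" for x y
      using rep[of "[k, y]"] that M[OF k(1)] by auto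
    then have "z \<in> ?R" if "z \<in> ?L" for z using that by (cases z) auto
    moreover have "?R \<subseteq> ?L" by auto
    ultimately show ?thesis by blast
  qed
  have "finite Z" unfolding Z_def P_def N_def
    by (rule finite_zeros_lifted_poly[OF W'], subst X, rule finite_imageI, rule fin) simp
  then have "finite (solutions (2 * k) T)" using T by simp
  moreover obtain x where "length x = m" "mpoly_eval W (map int ([k, h k] @ x)) = 0"
    using rep[of "[k, h k]"] M[OF k(1)] by auto
  then obtain v where "v \<in> Z" "\<forall>i<Suc m. v ! Suc i = int ((h k # x) ! i)"
    using ex_zero_lifted_poly[OF W', of "h k # x" k] unfolding Z_def P_def N_def by auto
  then have v: "v \<in> Z" "v ! 1 = int (h k)" by force+
  have "(v @ g v @ map (\<lambda>i. int i + 1) [0..<2 * k - (N + c)]) ! 1 = int (h k)"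
    using v by (simp add: Z_def N_def nth_append)
  with v T obtain y where "y \<in> solutions (2 * k) T" "y ! 1 = int (h k)" by blast
  moreover have "1 < 2 * k" using k by simp
  ultimately show ?thesis using that k(1) T(1) by blast
qed

theorem corollary2:
  fixes f :: "nat \<Rightarrow> nat"
  assumes "computable_on_positive f"
  shows "\<not> ((\<forall>n\<ge>1. \<forall>S. S \<subseteq> E n \<longrightarrow> finite (solutions n S) \<longrightarrow>
               (\<forall>x\<in>solutions n S. \<forall>i<n. \<bar>x ! i\<bar> \<le> int (f n)))
           \<and> matiyasevich_conjecture)"
proof
  assume asm: "(\<forall>n\<ge>1. \<forall>S. S \<subseteq> E n \<longrightarrow> finite (solutions n S) \<longrightarrow>
               (\<forall>x\<in>solutions n S. \<forall>i<n. \<bar>x ! i\<bar> \<le> int (f n)))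
           \<and> matiyasevich_conjecture"
  obtain M where "recursively_enumerable 2 M"
    and M: "\<And>k y. k \<ge> 1 \<Longrightarrow> [k, y] \<in> M \<longleftrightarrow> y = Suc (f (2 * k))"
    using recursively_enumerable_Suc_double_graph[OF assms] by blast
  then have "finite_fold_diophantine 2 M"
    using asm by (auto simp: matiyasevich_conjecture_def)
  then obtain k S x where "k \<ge> 1" "S \<subseteq> E (2 * k)" "finite (solutions (2 * k) S)"
    "x \<in> solutions (2 * k) S" "1 < 2 * k" and x: "x ! 1 = int (Suc (f (2 * k)))"
    using finite_system_with_large_solution[OF _ M] by metis
  moreover have "\<forall>S. S \<subseteq> E (2 * k) \<longrightarrow> finite (solutions (2 * k) S) \<longrightarrow>
      (\<forall>x\<in>solutions (2 * k) S. \<forall>i<2 * k. \<bar>x ! i\<bar> \<le> int (f (2 * k)))"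
    using asm \<open>k \<ge> 1\<close> by simp
  ultimately have "\<bar>x ! 1\<bar> \<le> int (f (2 * k))" by blast
  with x show False by simp
qed

end
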